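(* Let $A\in\mathbb{R}^{m\times n}$, $\lambda>0$, and let $f(z)=\sum_{i=1}^m\log(1+e^{-z_i})$ for $z\in\mathbb{R}^m$ and $g(x)=\lambda\|x\|_1$ for $x\in\mathbb{R}^n$. Let $P(x)=f(Ax)+g(x)$ and $D(u)=-f^*(-u)-g^*(A^{\top}u)$. Let $\gamma>0$, let $$x^\star_\gamma\in\operatorname*{arg\,min}_{x\in\mathbb{R}^n} f(Ax)+\gamma g(x),$$ and set $(x,u)=\bigl(x^\star_\gamma,\,-\gamma^{-1}\nabla f(Ax^\star_\gamma)\bigr)$. Then $$\mathcal{B}(c_{\mathrm{SFER}},r_{\mathrm{SFER}})=\mathcal{B}_{\mathrm{RYU}}(x,u),$$ where $$c_{\mathrm{SFER}}=\tfrac12(1+\gamma)u,\qquad r_{\mathrm{SFER}}=\sqrt{\tfrac14\,\mathrm{Breg}(x,u)-\tfrac14\|(1-\gamma)u\|_2^2}.$$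
   Context: $h^*(z^* )=\sup_z \langle z^*,z\rangle-h(z)$ denotes the convex conjugate of $h$, and $\mathrm{dom}(h)=\{z: h(z)<+\infty\}$. $\mathcal{B}(c,r)=\{v\in\mathbb{R}^m:\|v-c\|_2\le r\}$ for $r\ge 0$, with $\mathcal{B}(c,+\infty)=\mathbb{R}^m$. The Bregman-type divergence is $$\mathrm{Breg}(x,u)=f^*(-u)-f^*(\nabla f(Ax))+\langle Ax,\,u+\nabla f(Ax)\rangle.$$ For a problem in which $\nabla f$ is $\alpha^{-1}$-Lipschitz, the RYU ball is $\mathcal{B}_{\mathrm{RYU}}(x,u)=\mathcal{B}(c_{\mathrm{RYU}},r_{\mathrm{RYU}})$ with $c_{\mathrm{RYU}}=\frac12(u-\nabla f(Ax))$ and $r_{\mathrm{RYU}}=\sqrt{\frac{P(x)-D(u)}{\alpha}-\frac{\|u+\nabla f(Ax)\|_2^2}{4}}$; the quantity under the square root is nonnegative (and is $+\infty$, giving an infinite radius, when $(x,u)\notin\mathrm{dom}(P)\times\mathrm{dom}(-D)$). Here $f$ is the logistic loss above and $\alpha=4$. *)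

theory Defs
  imports "HOL-Analysis.Analysis"
begin

definition conjugate :: "('a::real_inner \<Rightarrow> ereal) \<Rightarrow> 'a \<Rightarrow> ereal" where
  "conjugate h y = (SUP z. ereal (y \<bullet> z) - h z)"

text \<open>Meaningful where the function is differentiable (see \<open>gradient_eqI\<close>).\<close>

definition gradient :: "('a::real_inner \<Rightarrow> real) \<Rightarrow> 'a \<Rightarrow> 'a" where
  "gradient f z = (THE d. GDERIV f z :> d)"

lemma gradient_eqI:
  assumes "GDERIV f z :> d"
  shows "gradient f z = d"
  unfolding gradient_def
proof (rule the_equality)
  show "GDERIV f z :> d" by (fact assms)
next
  fix d' assume "GDERIV f z :> d'"
  with assms have "(\<lambda>h. h \<bullet> d') = (\<lambda>h. h \<bullet> d)"
    unfolding gderiv_def by (rule has_derivative_unique[rotated])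
  then have "\<And>h. h \<bullet> d' = h \<bullet> d" by meson
  then show "d' = d" by (metis inner_commute vector_eq_ldot)
qed

text \<open>Square root on \<open>[0, \<infinity>]\<close>; values at negative arguments are irrelevant.\<close>

definition ereal_sqrt :: "ereal \<Rightarrow> ereal" where
  "ereal_sqrt t = (if t = \<infinity> then \<infinity> else ereal (sqrt (real_of_ereal t)))"

definition ecball :: "'a::real_normed_vector \<Rightarrow> ereal \<Rightarrow> 'a set" where
  "ecball c r = {v. ereal (norm (v - c)) \<le> r}"

lemma ecball_ereal: "ecball c (ereal r) = cball c r"
  by (auto simp: ecball_def dist_norm norm_minus_commute)

lemma ecball_infinity: "ecball c \<infinity> = UNIV"
  by (simp add: ecball_def)

definition primal ::
  "(real^'m \<Rightarrow> real) \<Rightarrow> (real^'n \<Rightarrow> ereal) \<Rightarrow> real^'n^'m \<Rightarrow> real^'n \<Rightarrow> ereal" where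
  "primal f g A x = ereal (f (A *v x)) + g x"

definition dual ::
  "(real^'m \<Rightarrow> real) \<Rightarrow> (real^'n \<Rightarrow> ereal) \<Rightarrow> real^'n^'m \<Rightarrow> real^'m \<Rightarrow> ereal" where
  "dual f g A u = - conjugate (\<lambda>z. ereal (f z)) (- u) - conjugate g (transpose A *v u)"

definition breg ::
  "(real^'m \<Rightarrow> real) \<Rightarrow> real^'n^'m \<Rightarrow> real^'n \<Rightarrow> real^'m \<Rightarrow> ereal" where
  "breg f A x u =
     conjugate (\<lambda>z. ereal (f z)) (- u)
     - conjugate (\<lambda>z. ereal (f z)) (gradient f (A *v x))
     + ereal ((A *v x) \<bullet> (u + gradient f (A *v x)))"

definition ryu_center ::
  "(real^'m \<Rightarrow> real) \<Rightarrow> real^'n^'m \<Rightarrow> real^'n \<Rightarrow> real^'m \<Rightarrow> real^'m" where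
  "ryu_center f A x u = (1/2) *\<^sub>R (u - gradient f (A *v x))"

text \<open>For proper \<open>g\<close>, extended arithmetic makes the duality gap, hence the radius, infinite
  exactly when \<open>x\<close> is outside the domain of the primal or \<open>u\<close> outside the domain of minus the
  dual (see \<open>ryu_radius_eq_infinity_iff\<close>).\<close>

definition ryu_radius ::
  "(real^'m \<Rightarrow> real) \<Rightarrow> (real^'n \<Rightarrow> ereal) \<Rightarrow> real^'n^'m \<Rightarrow> real \<Rightarrow> real^'n \<Rightarrow> real^'m \<Rightarrow> ereal"
  where
  "ryu_radius f g A \<alpha> x u =
     ereal_sqrt ((primal f g A x - dual f g A u) / ereal \<alpha>
                 - ereal ((norm (u + gradient f (A *v x)))\<^sup>2 / 4))"

definition ryu_ball ::
  "(real^'m \<Rightarrow> real) \<Rightarrow> (real^'n \<Rightarrow> ereal) \<Rightarrow> real^'n^'m \<Rightarrow> real \<Rightarrow> real^'n \<Rightarrow> real^'m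
     \<Rightarrow> (real^'m) set" where
  "ryu_ball f g A \<alpha> x u = ecball (ryu_center f A x u) (ryu_radius f g A \<alpha> x u)"

lemma conjugate_neq_minf:
  assumes "h z \<noteq> \<infinity>"
  shows "conjugate h y \<noteq> -\<infinity>"
proof -
  have "ereal (y \<bullet> z) - h z \<le> conjugate h y"
    unfolding conjugate_def by (rule SUP_upper) simp
  with assms show ?thesis by (cases "h z") auto
qed

lemma ryu_radius_eq_infinity_iff:
  assumes "\<And>y. g y \<noteq> -\<infinity>" and "g y0 \<noteq> \<infinity>" and "\<alpha> > 0"
  shows "ryu_radius f g A \<alpha> x u = \<infinity> \<longleftrightarrow> \<not> (primal f g A x < \<infinity> \<and> - dual f g A u < \<infinity>)"
proof -
  have p: "primal f g A x \<noteq> -\<infinity>"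
    using assms(1)[of x] by (cases "g x") (auto simp: primal_def)
  have "conjugate (\<lambda>z. ereal (f z)) (- u) \<noteq> -\<infinity>"
    by (rule conjugate_neq_minf[where z = 0]) simp
  moreover have "conjugate g (transpose A *v u) \<noteq> -\<infinity>"
    using assms(2) by (rule conjugate_neq_minf[where h = g and z = y0])
  ultimately have d: "dual f g A u \<noteq> \<infinity>"
    unfolding dual_def
    by (cases "conjugate (\<lambda>z. ereal (f z)) (- u)"; cases "conjugate g (transpose A *v u)") auto
  show ?thesis
    using p d assms(3) unfolding ryu_radius_def ereal_sqrt_def
    by (cases "primal f g A x"; cases "dual f g A u") auto
qed

end

theory Submission
  imports Defs
begin

text \<open>Optimality of \<open>x\<close> says that \<open>A\<^sup>T u\<close> is a subgradient of \<open>g\<close> at \<open>x\<close>, so Fenchel's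
  equality holds both for \<open>g\<close> at \<open>(x, A\<^sup>T u)\<close> and for \<open>f\<close> at \<open>(A x, \<nabla>f (A x))\<close>. Substituting the
  two equalities turns the duality gap \<open>P x - D u\<close> into \<open>Breg x u\<close>; the centers agree because
  \<open>\<nabla>f (A x) = -\<gamma> u\<close>.\<close>

text \<open>Fenchel's equality: the subgradient inequality rearranges to
  \<open>y \<bullet> z - h z \<le> y \<bullet> w - h w\<close>, so the supremum defining the
  conjugate is attained at \<open>w\<close>. The value is therefore finite.\<close>

lemma conjugate_subgradient:
  fixes h :: "'a::real_inner \<Rightarrow> real"
  assumes "\<And>z. h w + y \<bullet> (z - w) \<le> h z"
  shows "conjugate (\<lambda>z. ereal (h z)) y = ereal (y \<bullet> w - h w)"
  unfolding conjugate_def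
proof (rule antisym)
  show "(SUP z. ereal (y \<bullet> z) - ereal (h z)) \<le> ereal (y \<bullet> w - h w)"
  proof (rule SUP_least)
    fix z show "ereal (y \<bullet> z) - ereal (h z) \<le> ereal (y \<bullet> w - h w)"
      using assms[of z] by (simp add: inner_diff_right)
  qed
  have "ereal (y \<bullet> w) - ereal (h w) \<le> (SUP z. ereal (y \<bullet> z) - ereal (h z))"
    by (rule SUP_upper) simp
  then show "ereal (y \<bullet> w - h w) \<le> (SUP z. ereal (y \<bullet> z) - ereal (h z))"
    by simp
qed

text \<open>The difference quotients for \<open>t\<close> in (0, 1] are at least \<open>c\<close>,
  and this survives the limit from the right. A one-sided bound is what minimality along a segment
  provides.\<close>

lemma DERIV_ge_if_right_secants_ge:
  fixes \<phi> :: "real \<Rightarrow> real"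
  assumes "DERIV \<phi> 0 :> D"
    and "\<And>t. 0 < t \<Longrightarrow> t \<le> 1 \<Longrightarrow> \<phi> 0 + t * c \<le> \<phi> t"
  shows "c \<le> D"
proof (rule tendsto_lowerbound)
  show "((\<lambda>t. (\<phi> (0 + t) - \<phi> 0) / t) \<longlongrightarrow> D) (at_right 0)"
    using assms(1) unfolding DERIV_def by (rule tendsto_within_subset) simp
  have "eventually (\<lambda>t::real. 0 < t \<and> t < 1) (at_right 0)"
    by (auto simp: eventually_at_right_field intro: exI[of _ 1])
  then show "eventually (\<lambda>t. c \<le> (\<phi> (0 + t) - \<phi> 0) / t) (at_right 0)"
  proof eventually_elim
    case (elim t)
    then show ?case using assms(2)[of t] by (simp add: field_simps)
  qed
qed simp

lemma GDERIV_compose_matrix_line: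
  fixes A :: "real^'n^'m" and f :: "real^'m \<Rightarrow> real"
  assumes "GDERIV f (A *v x) :> d"
  shows "DERIV (\<lambda>t. f (A *v (x + t *\<^sub>R v))) 0 :> d \<bullet> (A *v v)"
proof -
  have "((\<lambda>t::real. A *v x + t *\<^sub>R (A *v v)) has_derivative (\<lambda>t. t *\<^sub>R (A *v v))) (at 0)"
    by (auto intro!: derivative_eq_intros)
  moreover have "(f has_derivative (\<lambda>h. h \<bullet> d)) (at (A *v x + 0 *\<^sub>R (A *v v)))"
    using assms by (simp add: gderiv_def)
  ultimately have "((\<lambda>t. f (A *v x + t *\<^sub>R (A *v v)))
      has_derivative (\<lambda>t. (t *\<^sub>R (A *v v)) \<bullet> d)) (at 0)"
    by (rule has_derivative_compose)
  then show ?thesis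
    by (simp add: has_field_derivative_def matrix_vector_right_distrib
        matrix_vector_mult_scaleR inner_commute mult_commute_abs)
qed

text \<open>First-order optimality when only the loss is differentiable: \<open>x\<close> is
  compared with points of the segment towards \<open>y\<close>, convexity bounds the change of
  \<open>g\<close> linearly in \<open>t\<close>, and the limit at 0 replaces the loss by its
  directional derivative. Dividing by \<gamma> and transposing \<open>A\<close> gives the
  subgradient inequality.\<close>

lemma subgradient_at_regularized_minimizer:
  fixes A :: "real^'n^'m" and f :: "real^'m \<Rightarrow> real" and g :: "real^'n \<Rightarrow> real"
  assumes deriv: "GDERIV f (A *v x) :> d"
    and convex: "convex_on UNIV g"
    and "\<gamma> > 0"
    and min: "\<And>y. f (A *v x) + \<gamma> * g x \<le> f (A *v y) + \<gamma> * g y"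
  shows "g x + (transpose A *v (- (inverse \<gamma> *\<^sub>R d))) \<bullet> (y - x) \<le> g y"
proof -
  have "\<gamma> * (g x - g y) \<le> d \<bullet> (A *v (y - x))"
  proof (rule DERIV_ge_if_right_secants_ge)
    show "DERIV (\<lambda>t. f (A *v (x + t *\<^sub>R (y - x)))) 0 :> d \<bullet> (A *v (y - x))"
      using deriv by (rule GDERIV_compose_matrix_line)
    fix t :: real
    assume t: "0 < t" "t \<le> 1"
    have "g (x + t *\<^sub>R (y - x)) = g ((1 - t) *\<^sub>R x + t *\<^sub>R y)"
      by (simp add: algebra_simps)
    also have "\<dots> \<le> (1 - t) * g x + t * g y"
      using convex_onD[OF convex, of t x y] t by simp
    finally have "\<gamma> * g (x + t *\<^sub>R (y - x)) \<le> \<gamma> * ((1 - t) * g x + t * g y)"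
      using \<open>\<gamma> > 0\<close> by simp
    \<comment> \<open>In minimality at the segment point the terms \<open>\<gamma> * g x\<close>
      cancel, leaving a secant bound with slope \<open>\<gamma> * (g x - g y)\<close>.\<close>
    with min[of "x + t *\<^sub>R (y - x)"]
    show "f (A *v (x + 0 *\<^sub>R (y - x))) + t * (\<gamma> * (g x - g y)) \<le> f (A *v (x + t *\<^sub>R (y - x)))"
      by (simp add: algebra_simps)
  qed
  moreover have "(transpose A *v (- (inverse \<gamma> *\<^sub>R d))) \<bullet> (y - x)
      = - (inverse \<gamma> * (d \<bullet> (A *v (y - x))))"
    by (simp add: dot_lmul_matrix transpose_matrix_vector)
  moreover have "g x - g y \<le> inverse \<gamma> * (d \<bullet> (A *v (y - x)))"
    using calculation(1) \<open>\<gamma> > 0\<close> by (simp add: field_simps)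
  ultimately show ?thesis
    by linarith
qed

lemma duality_gap_eq_breg:
  fixes A :: "real^'n^'m" and f :: "real^'m \<Rightarrow> real" and g :: "real^'n \<Rightarrow> real"
  assumes "\<And>z. f (A *v x) + gradient f (A *v x) \<bullet> (z - A *v x) \<le> f z"
    and "\<And>y. g x + (transpose A *v u) \<bullet> (y - x) \<le> g y"
  shows "primal f (\<lambda>y. ereal (g y)) A x - dual f (\<lambda>y. ereal (g y)) A u = breg f A x u"
proof -
  \<comment> \<open>The conjugate of \<open>f\<close> at \<open>-u\<close> is not evaluated: it
    occurs on both sides and may be infinite, in which case both sides are \<infinity>. Only the
    value -\<infinity> has to be excluded.\<close>
  have "conjugate (\<lambda>z. ereal (f z)) (- u) \<noteq> -\<infinity>"
    by (rule conjugate_neq_minf[where z = 0]) simp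
  moreover have "(transpose A *v u) \<bullet> x = (A *v x) \<bullet> u"
    by (metis dot_lmul_matrix inner_commute transpose_matrix_vector)
  ultimately show ?thesis
    unfolding primal_def dual_def breg_def
      conjugate_subgradient[OF assms(1)] conjugate_subgradient[OF assms(2)]
    by (cases "conjugate (\<lambda>z. ereal (f z)) (- u)")
      (simp_all add: inner_add_right inner_commute)
qed

text \<open>The chain rule yields \<open>- exp (- t) / (1 + exp (- t))\<close>; multiplying through
  by \<open>exp t\<close> gives a form that is visibly increasing in \<open>t\<close>.\<close>

lemma DERIV_logistic:
  "((\<lambda>s::real. ln (1 + exp (- s))) has_real_derivative - (1 / (1 + exp t))) (at t)"
proof -
  have "0 < 1 + exp (- t)" by (simp add: add_pos_pos)
  then show ?thesis
    by (auto intro!: derivative_eq_intros simp: exp_minus divide_simps add_pos_pos)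
       (simp_all add: add_eq_0_iff algebra_simps)
qed

text \<open>The derivative is monotone, so the scalar loss is convex and lies above each of its
  tangents.\<close>

lemma logistic_above_tangent:
  "ln (1 + exp (- t)) + - (1 / (1 + exp t)) * (s - t) \<le> ln (1 + exp (- s))" for s t :: real
proof -
  have "convex_on UNIV (\<lambda>s::real. ln (1 + exp (- s)))"
  proof (rule convex_on_realI)
    fix a b :: real
    assume "a \<le> b"
    then show "- (1 / (1 + exp a)) \<le> - (1 / (1 + exp b))"
      by (simp add: frac_le add_pos_pos)
  qed (auto intro: DERIV_logistic)
  from convex_on_imp_above_tangent[OF this _ _ _ DERIV_logistic, of t s]
  show ?thesis by simp
qed

lemma GDERIV_logistic_loss:
  fixes w :: "real^'m"
  shows "GDERIV (\<lambda>z. \<Sum>i\<in>UNIV. ln (1 + exp (- (z $ i)))) w :> (\<chi> i. - (1 / (1 + exp (w $ i))))"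
proof -
  have "((\<lambda>z::real^'m. ln (1 + exp (- (z $ i)))) has_derivative
      (\<lambda>h. - (1 / (1 + exp (w $ i))) * (h $ i))) (at w)" for i
    by (rule has_derivative_compose[OF _ DERIV_logistic[unfolded has_field_derivative_def],
          where f = "\<lambda>z. z $ i"])
       (auto intro: bounded_linear_imp_has_derivative bounded_linear_vec_nth)
  then have "((\<lambda>z::real^'m. \<Sum>i\<in>UNIV. ln (1 + exp (- (z $ i)))) has_derivative
      (\<lambda>h. \<Sum>i\<in>UNIV. - (1 / (1 + exp (w $ i))) * (h $ i))) (at w)"
    by (intro has_derivative_sum)
  then show ?thesis
    by (simp add: gderiv_def inner_vec_def mult.commute)
qed

text \<open>The loss is separable, so the scalar tangent inequalities add up over the
  coordinates.\<close>

lemma logistic_loss_above_tangent: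
  fixes w z :: "real^'m"
  shows "(\<Sum>i\<in>UNIV. ln (1 + exp (- (w $ i)))) + (\<chi> i. - (1 / (1 + exp (w $ i)))) \<bullet> (z - w)
    \<le> (\<Sum>i\<in>UNIV. ln (1 + exp (- (z $ i))))"
proof -
  have "(\<Sum>i\<in>UNIV. ln (1 + exp (- (w $ i))) + - (1 / (1 + exp (w $ i))) * (z $ i - w $ i))
      \<le> (\<Sum>i\<in>UNIV. ln (1 + exp (- (z $ i))))"
    by (intro sum_mono logistic_above_tangent)
  then show ?thesis
    by (simp add: inner_vec_def sum.distrib sum_subtractf sum_negf)
qed

lemma convex_on_l1_norm:
  fixes lam :: real
  assumes "lam \<ge> 0"
  shows "convex_on UNIV (\<lambda>y::real^'n. lam * (\<Sum>j\<in>UNIV. \<bar>y $ j\<bar>))"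
proof (rule convex_on_cmul[OF assms], rule convex_onI)
  fix t :: real and a b :: "real^'n"
  assume t: "0 < t" "t < 1"
  have "\<bar>(1 - t) * a $ j + t * b $ j\<bar> \<le> (1 - t) * \<bar>a $ j\<bar> + t * \<bar>b $ j\<bar>" for j
    using abs_triangle_ineq[of "(1 - t) * a $ j" "t * b $ j"] t by (simp add: abs_mult)
  then show "(\<Sum>j\<in>UNIV. \<bar>((1 - t) *\<^sub>R a + t *\<^sub>R b) $ j\<bar>)
      \<le> (1 - t) * (\<Sum>j\<in>UNIV. \<bar>a $ j\<bar>) + t * (\<Sum>j\<in>UNIV. \<bar>b $ j\<bar>)"
    by (simp add: sum_distrib_left sum.distrib[symmetric] sum_mono)
qed simp

theorem proposition4p9:
  fixes A :: "real^'n^'m" and lam \<gamma> :: real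
    and f :: "real^'m \<Rightarrow> real" and g :: "real^'n \<Rightarrow> ereal"
    and x :: "real^'n" and u :: "real^'m"
  assumes "lam > 0"
    and "f = (\<lambda>z. \<Sum>i\<in>UNIV. ln (1 + exp (- (z $ i))))"
    and "g = (\<lambda>y. ereal (lam * (\<Sum>j\<in>UNIV. \<bar>y $ j\<bar>)))"
    and "\<gamma> > 0"
    and "is_arg_min (\<lambda>y. ereal (f (A *v y)) + ereal \<gamma> * g y) (\<lambda>y. True) x"
    and "u = - (inverse \<gamma> *\<^sub>R gradient f (A *v x))"
  shows "ecball ((1/2 * (1 + \<gamma>)) *\<^sub>R u)
           (ereal_sqrt (ereal (1/4) * breg f A x u
                        - ereal (1/4 * (norm ((1 - \<gamma>) *\<^sub>R u))\<^sup>2)))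
         = ryu_ball f g A 4 x u"
proof -
  define d where "d = gradient f (A *v x)"
  \<comment> \<open>A real-valued copy of \<open>g\<close>, since subgradients and convexity are
    treated for real functions.\<close>
  define l where "l = (\<lambda>y::real^'n. lam * (\<Sum>j\<in>UNIV. \<bar>y $ j\<bar>))"
  have g: "g = (\<lambda>y. ereal (l y))"
    by (simp add: assms(3) l_def)
  have d_eq: "d = (\<chi> i. - (1 / (1 + exp ((A *v x) $ i))))"
    unfolding d_def assms(2) by (rule gradient_eqI[OF GDERIV_logistic_loss])
  have deriv: "GDERIV f (A *v x) :> d"
    unfolding d_eq assms(2) by (rule GDERIV_logistic_loss)
  have tangent: "f (A *v x) + gradient f (A *v x) \<bullet> (z - A *v x) \<le> f z" for z
    unfolding d_def[symmetric] unfolding d_eq assms(2) by (rule logistic_loss_above_tangent)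
  have "f (A *v x) + \<gamma> * l x \<le> f (A *v y) + \<gamma> * l y" for y
    using assms(5) by (auto simp: is_arg_min_linorder g)
  then have "l x + (transpose A *v u) \<bullet> (y - x) \<le> l y" for y
    using deriv convex_on_l1_norm[of lam] assms(1,4)
    unfolding assms(6) d_def[symmetric]
    by (intro subgradient_at_regularized_minimizer[where f = f]) (simp_all add: l_def)
  with tangent have gap: "primal f g A x - dual f g A u = breg f A x u"
    unfolding g by (rule duality_gap_eq_breg)
  \<comment> \<open>Hence \<open>u - d = (1 + \<gamma>) *\<^sub>R u\<close> settles the center, and
    \<open>u + d = (1 - \<gamma>) *\<^sub>R u\<close> the norm term of the radius.\<close>
  have "d = - (\<gamma> *\<^sub>R u)"
    using assms(4,6) by (simp add: d_def)
  then have "ryu_center f A x u = (1/2 * (1 + \<gamma>)) *\<^sub>R u"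
    and "u + gradient f (A *v x) = (1 - \<gamma>) *\<^sub>R u"
    by (simp_all add: ryu_center_def d_def[symmetric] algebra_simps add_divide_distrib)
  \<comment> \<open>The factor 1/4 in the radius is division by \<alpha> = 4; the divergence may be
    infinite, hence the case split.\<close>
  moreover have "breg f A x u / ereal 4 = ereal (1/4) * breg f A x u"
    by (cases "breg f A x u") auto
  ultimately show ?thesis
    by (simp add: ryu_ball_def ryu_radius_def gap)
qed

end
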